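(* Let $G$ be a simply connected nilpotent Lie group with Lie algebra $\mathfrak g$, let $\Gamma\subset G$ be a discrete co-compact subgroup, and let $J$ be an abelian invariant complex structure on $M=\Gamma\backslash G$. Let $\Phi\in\mathfrak g^{*(0,1)}\otimes\mathfrak g^{1,0}$ be small, so that it defines an invariant almost complex structure $J_\Phi$ on $M$. Then $\Phi$ defines an abelian deformation (that is, $J_\Phi$ is an abelian complex structure) if and only if $\Phi$ is integrable and $$\{\overline{\Phi},\ \omega-\Phi(\omega)\}=0\qquad\text{for every }\omega\in\mathfrak g^{*(1,0)}.$$
   Context: A complex structure $J$ on a Lie algebra $\mathfrak g$ is abelian if $[JA,JB]=[A,B]$ for all $A,B\in\mathfrak g$; equivalently $d\mathfrak g^{*(1,0)}\subset\mathfrak g^{*(1,1)}$. Invariant means induced by a left-invariant structure on $G$. Here $\mathfrak g\otimes\mathbb C=\mathfrak g^{1,0}\oplus\mathfrak g^{0,1}$ is the type decomposition with respect to $J$, $\mathfrak g^{*(p,q)}$ is the space of invariant $(p,q)$-forms, and $d$ is the exterior (Chevalley-Eilenberg) differential on invariant forms. An element $\Phi=\sum_i\bar\omega_i\otimes V_i\in\mathfrak g^{*(0,1)}\otimes\mathfrak g^{1,0}$ is viewed as a map $\mathfrak g^{0,1}\to\mathfrak g^{1,0}$, $\Phi(\bar X)=\sum_i\bar\omega_i(\bar X)V_i$, and as a map $\mathfrak g^{*(1,0)}\to\mathfrak g^{*(0,1)}$, $\Phi(\omega)=\sum_i\omega(V_i)\bar\omega_i$. Its complex conjugate $\overline\Phi\in\mathfrak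 g^{*(1,0)}\otimes\mathfrak g^{0,1}$ is viewed likewise as a map $\mathfrak g^{1,0}\to\mathfrak g^{0,1}$. For $\Phi$ small (so that the space $\{\bar X+\Phi(\bar X):\bar X\in\mathfrak g^{0,1}\}$ and its complex conjugate are complementary in $\mathfrak g\otimes\mathbb C$), $J_\Phi$ is the invariant almost complex structure whose $(1,0)$-forms are $\omega-\Phi(\omega)$, $\omega\in\mathfrak g^{*(1,0)}$, and whose $(0,1)$-vectors are $\bar X+\Phi(\bar X)$, $\bar X\in\mathfrak g^{0,1}$. $\Phi$ is called integrable if $J_\Phi$ is integrable, i.e. $$\bigl(d(\omega-\Phi(\omega))\bigr)(\bar X+\Phi(\bar X),\bar Y+\Phi(\bar Y))=0\quad\text{for all }\omega\in\mathfrak g^{*(1,0)},\ \bar X,\bar Y\in\mathfrak g^{0,1}.$$ The bracket is the extended Schouten-Nijenhuis bracket: for $\alpha\in\mathfrak g^{*(1,0)}$, $\bar V\in\mathfrak g^{0,1}$ and an invariant $1$-form $\eta\in\mathfrak g^{*(1,0)}\oplus\mathfrak g^{*(0,1)}$, $$\{\alpha\otimes\bar V,\eta\}=\alpha\wedge\iota_{\bar V}d\eta,$$ extended linearly in the first argument. *)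

theory Defs
  imports "HOL-Analysis.Analysis" "HOL-Algebra.Coset" "HOL-Algebra.Generated_Groups"
begin

section \<open>Smooth maps between open sets of finite-dimensional normed spaces\<close>

text \<open>For a finite-dimensional domain this is the usual class $C^k$: the derivative is of class
  $C^k$ iff all directional derivatives are.\<close>

primrec C_k_on :: "nat \<Rightarrow> 'a::real_normed_vector set \<Rightarrow> ('a \<Rightarrow> 'b::real_normed_vector) \<Rightarrow> bool" where
  "C_k_on 0 S f \<longleftrightarrow> continuous_on S f"
| "C_k_on (Suc k) S f \<longleftrightarrow>
    (\<exists>D. (\<forall>x\<in>S. (f has_derivative D x) (at x)) \<and> (\<forall>v. C_k_on k S (\<lambda>x. D x v)))"

definition smooth_on :: "'a::real_normed_vector set \<Rightarrow> ('a \<Rightarrow> 'b::real_normed_vector) \<Rightarrow> bool" where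
  "smooth_on S f \<longleftrightarrow> (\<forall>k. C_k_on k S f)"


section \<open>Lie groups\<close>

text \<open>The model space \<open>'e\<close> is an arbitrary finite-dimensional real normed space; unlike
  \<open>euclidean_space\<close>, this does not exclude dimension zero. A chart is a pair of its open domain
  and a coordinate map, the latter relevant only on the domain.\<close>

locale lie_group = group G
  for G :: "('g::{t2_space,second_countable_topology}, 'm) monoid_scheme" (structure) +
  fixes atlas :: "('g set \<times> ('g \<Rightarrow> 'e::real_normed_vector)) set"
  assumes carrier_UNIV: "carrier G = UNIV"
    and finite_dim_model: "\<exists>B::'e set. finite B \<and> span B = UNIV"
    and chart: "\<And>U \<phi>. (U, \<phi>) \<in> atlas \<Longrightarrow>
      open U \<and> open (\<phi> ` U) \<and> homeomorphism U (\<phi> ` U) \<phi> (inv_into U \<phi>)"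
    and charts_cover: "(\<Union>(U, \<phi>)\<in>atlas. U) = UNIV"
    and smooth_transition: "\<And>U \<phi> V \<psi>. (U, \<phi>) \<in> atlas \<Longrightarrow> (V, \<psi>) \<in> atlas \<Longrightarrow>
      smooth_on (\<phi> ` (U \<inter> V)) (\<psi> \<circ> inv_into U \<phi>)"
    and continuous_mult: "continuous_on UNIV (\<lambda>(x, y). x \<otimes> y)"
    and smooth_mult: "\<And>U \<phi> V \<psi> W \<theta>.
      (U, \<phi>) \<in> atlas \<Longrightarrow> (V, \<psi>) \<in> atlas \<Longrightarrow> (W, \<theta>) \<in> atlas \<Longrightarrow>
      smooth_on {(u, v). u \<in> \<phi> ` U \<and> v \<in> \<psi> ` V \<and> inv_into U \<phi> u \<otimes> inv_into V \<psi> v \<in> W}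
        (\<lambda>(u, v). \<theta> (inv_into U \<phi> u \<otimes> inv_into V \<psi> v))"
    and continuous_inverse: "continuous_on UNIV (\<lambda>x. m_inv G x)"
    and smooth_inverse: "\<And>U \<phi> V \<psi>. (U, \<phi>) \<in> atlas \<Longrightarrow> (V, \<psi>) \<in> atlas \<Longrightarrow>
      smooth_on {u. u \<in> \<phi> ` U \<and> m_inv G (inv_into U \<phi> u) \<in> V}
        (\<lambda>u. \<psi> (m_inv G (inv_into U \<phi> u)))"

primrec lower_central_series :: "('g, 'm) monoid_scheme \<Rightarrow> nat \<Rightarrow> 'g set" where
  "lower_central_series G 0 = carrier G"
| "lower_central_series G (Suc n) =
    generate G {x \<otimes>\<^bsub>G\<^esub> y \<otimes>\<^bsub>G\<^esub> m_inv G x \<otimes>\<^bsub>G\<^esub> m_inv G y | x y.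
      x \<in> carrier G \<and> y \<in> lower_central_series G n}"

definition nilpotent_group :: "('g, 'm) monoid_scheme \<Rightarrow> bool" where
  "nilpotent_group G \<longleftrightarrow> group G \<and> (\<exists>n. lower_central_series G n = {\<one>\<^bsub>G\<^esub>})"

text \<open>The space $\Gamma\backslash G$ of cosets $\Gamma g$ with the quotient topology.\<close>

definition coset_space :: "('g::topological_space, 'm) monoid_scheme \<Rightarrow> 'g set \<Rightarrow> 'g set topology" where
  "coset_space G \<Gamma> = topology (\<lambda>\<U>. \<U> \<subseteq> rcosets\<^bsub>G\<^esub> \<Gamma> \<and> open {g. \<Gamma> #>\<^bsub>G\<^esub> g \<in> \<U>})"

lemma openin_coset_space:
  "openin (coset_space G \<Gamma>) \<U> \<longleftrightarrow> \<U> \<subseteq> rcosets\<^bsub>G\<^esub> \<Gamma> \<and> open {g. \<Gamma> #>\<^bsub>G\<^esub> g \<in> \<U>}"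
proof -
  have "istopology (\<lambda>\<U>. \<U> \<subseteq> rcosets\<^bsub>G\<^esub> \<Gamma> \<and> open {g. \<Gamma> #>\<^bsub>G\<^esub> g \<in> \<U>})"
    unfolding istopology_def
  proof (intro conjI allI impI)
    fix \<K> :: "'a set set set"
    assume *: "\<forall>K\<in>\<K>. K \<subseteq> rcosets\<^bsub>G\<^esub> \<Gamma> \<and> open {g. \<Gamma> #>\<^bsub>G\<^esub> g \<in> K}"
    have "{g. \<Gamma> #>\<^bsub>G\<^esub> g \<in> \<Union>\<K>} = (\<Union>K\<in>\<K>. {g. \<Gamma> #>\<^bsub>G\<^esub> g \<in> K})" by auto
    with * show "open {g. \<Gamma> #>\<^bsub>G\<^esub> g \<in> \<Union>\<K>}" by auto
    from * show "\<Union>\<K> \<subseteq> rcosets\<^bsub>G\<^esub> \<Gamma>" by auto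
  qed (auto simp: open_Int Collect_conj_eq)
  then show ?thesis by (simp add: coset_space_def topology_inverse')
qed

definition cocompact_lattice :: "('g::topological_space, 'm) monoid_scheme \<Rightarrow> 'g set \<Rightarrow> bool" where
  "cocompact_lattice G \<Gamma> \<longleftrightarrow> subgroup \<Gamma> G \<and> discrete \<Gamma> \<and> compact_space (coset_space G \<Gamma>)"


section \<open>The Lie algebra of a Lie group\<close>

definition smooth_functions :: "('g set \<times> ('g \<Rightarrow> 'e::real_normed_vector)) set \<Rightarrow> ('g \<Rightarrow> real) set" where
  "smooth_functions atlas = {f. \<forall>(U, \<phi>)\<in>atlas. smooth_on (\<phi> ` U) (f \<circ> inv_into U \<phi>)}"

text \<open>Left-invariant vector fields, as derivations of the algebra of smooth functions. The value on
  functions that are not smooth is irrelevant and is fixed to be 0.\<close>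

definition left_invariant_fields ::
  "('g, 'm) monoid_scheme \<Rightarrow> ('g set \<times> ('g \<Rightarrow> 'e::real_normed_vector)) set \<Rightarrow> (('g \<Rightarrow> real) \<Rightarrow> 'g \<Rightarrow> real) set"
  where
  "left_invariant_fields G atlas = {X.
     (\<forall>f\<in>smooth_functions atlas. X f \<in> smooth_functions atlas) \<and>
     (\<forall>f\<in>smooth_functions atlas. \<forall>h\<in>smooth_functions atlas. \<forall>r s.
        X (\<lambda>x. r * f x + s * h x) = (\<lambda>x. r * X f x + s * X h x)) \<and>
     (\<forall>f\<in>smooth_functions atlas. \<forall>h\<in>smooth_functions atlas.
        X (\<lambda>x. f x * h x) = (\<lambda>x. X f x * h x + f x * X h x)) \<and>
     (\<forall>f\<in>smooth_functions atlas. \<forall>a\<in>carrier G.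
        X (\<lambda>x. f (a \<otimes>\<^bsub>G\<^esub> x)) = (\<lambda>x. X f (a \<otimes>\<^bsub>G\<^esub> x))) \<and>
     (\<forall>f. f \<notin> smooth_functions atlas \<longrightarrow> X f = (\<lambda>x. 0))}"

text \<open>The real vector space \<open>'v\<close> with bracket \<open>lie\<close> is the Lie algebra of \<open>G\<close>: the map \<open>\<rho>\<close>
  identifies it with the left-invariant vector fields and their commutator. All algebraic
  properties of \<open>lie\<close> (bilinearity, antisymmetry, Jacobi identity) follow from this.\<close>

definition lie_algebra_of ::
  "('g, 'm) monoid_scheme \<Rightarrow> ('g set \<times> ('g \<Rightarrow> 'e::real_normed_vector)) set \<Rightarrow>
    ('v::real_vector \<Rightarrow> 'v \<Rightarrow> 'v) \<Rightarrow> ('v \<Rightarrow> ('g \<Rightarrow> real) \<Rightarrow> 'g \<Rightarrow> real) \<Rightarrow> bool" where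
  "lie_algebra_of G atlas lie \<rho> \<longleftrightarrow>
     bij_betw \<rho> UNIV (left_invariant_fields G atlas) \<and>
     (\<forall>A B f x. \<rho> (A + B) f x = \<rho> A f x + \<rho> B f x) \<and>
     (\<forall>r A f x. \<rho> (r *\<^sub>R A) f x = r * \<rho> A f x) \<and>
     (\<forall>A B f x. \<rho> (lie A B) f x = \<rho> A (\<rho> B f) x - \<rho> B (\<rho> A f) x)"


section \<open>The complexified Lie algebra and invariant forms\<close>

text \<open>The pair \<open>(A, B)\<close> stands for $A + iB \in \mathfrak g \otimes \mathbb C$. Addition is the one
  of the product type.\<close>

type_synonym 'v cplx = "'v \<times> 'v"

definition cscale :: "complex \<Rightarrow> 'v::real_vector cplx \<Rightarrow> 'v cplx" where
  "cscale c X = (Re c *\<^sub>R fst X - Im c *\<^sub>R snd X, Re c *\<^sub>R snd X + Im c *\<^sub>R fst X)"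

definition cconj :: "'v::real_vector cplx \<Rightarrow> 'v cplx" where
  "cconj X = (fst X, - snd X)"

definition cmap :: "('v \<Rightarrow> 'v) \<Rightarrow> 'v cplx \<Rightarrow> 'v cplx" where
  "cmap J X = (J (fst X), J (snd X))"

definition clie :: "('v::real_vector \<Rightarrow> 'v \<Rightarrow> 'v) \<Rightarrow> 'v cplx \<Rightarrow> 'v cplx \<Rightarrow> 'v cplx" where
  "clie lie X Y = (lie (fst X) (fst Y) - lie (snd X) (snd Y),
                   lie (fst X) (snd Y) + lie (snd X) (fst Y))"

text \<open>Invariant complex-valued 1-forms are complex-linear functionals on the complexification;
  invariant 2-forms are represented as functions of two arguments.\<close>

type_synonym 'v form1 = "'v cplx \<Rightarrow> complex"
type_synonym 'v form2 = "'v cplx \<Rightarrow> 'v cplx \<Rightarrow> complex"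

definition forms1 :: "'v::real_vector form1 set" where
  "forms1 = {\<eta>. (\<forall>X Y. \<eta> (X + Y) = \<eta> X + \<eta> Y) \<and> (\<forall>c X. \<eta> (cscale c X) = c * \<eta> X)}"

definition form_conj :: "'v::real_vector form1 \<Rightarrow> 'v form1" where
  "form_conj \<eta> = (\<lambda>X. cnj (\<eta> (cconj X)))"

definition wedge :: "'v form1 \<Rightarrow> 'v form1 \<Rightarrow> 'v form2" where
  "wedge \<alpha> \<beta> = (\<lambda>X Y. \<alpha> X * \<beta> Y - \<alpha> Y * \<beta> X)"

definition interior_mult :: "'v cplx \<Rightarrow> 'v form2 \<Rightarrow> 'v form1" where
  "interior_mult V \<sigma> = (\<lambda>X. \<sigma> V X)"

definition ext_d :: "('v::real_vector \<Rightarrow> 'v \<Rightarrow> 'v) \<Rightarrow> 'v form1 \<Rightarrow> 'v form2" where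
  "ext_d lie \<eta> = (\<lambda>X Y. - \<eta> (clie lie X Y))"


section \<open>Invariant complex structures\<close>

definition almost_complex :: "('v::real_vector \<Rightarrow> 'v) \<Rightarrow> bool" where
  "almost_complex J \<longleftrightarrow> linear J \<and> (\<forall>A. J (J A) = - A)"

definition vecs10 :: "('v::real_vector \<Rightarrow> 'v) \<Rightarrow> 'v cplx set" where
  "vecs10 J = {X. cmap J X = cscale \<i> X}"

definition vecs01 :: "('v::real_vector \<Rightarrow> 'v) \<Rightarrow> 'v cplx set" where
  "vecs01 J = {X. cmap J X = cscale (- \<i>) X}"

definition forms10 :: "('v::real_vector \<Rightarrow> 'v) \<Rightarrow> 'v form1 set" where
  "forms10 J = {\<omega> \<in> forms1. \<forall>X\<in>vecs01 J. \<omega> X = 0}"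

definition forms01 :: "('v::real_vector \<Rightarrow> 'v) \<Rightarrow> 'v form1 set" where
  "forms01 J = {\<omega> \<in> forms1. \<forall>X\<in>vecs10 J. \<omega> X = 0}"

definition complex_structure :: "('v::real_vector \<Rightarrow> 'v \<Rightarrow> 'v) \<Rightarrow> ('v \<Rightarrow> 'v) \<Rightarrow> bool" where
  "complex_structure lie J \<longleftrightarrow> almost_complex J \<and>
     (\<forall>\<omega>\<in>forms10 J. \<forall>X\<in>vecs01 J. \<forall>Y\<in>vecs01 J. ext_d lie \<omega> X Y = 0)"

definition abelian_complex_structure :: "('v::real_vector \<Rightarrow> 'v \<Rightarrow> 'v) \<Rightarrow> ('v \<Rightarrow> 'v) \<Rightarrow> bool" where
  "abelian_complex_structure lie J \<longleftrightarrow>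
     complex_structure lie J \<and> (\<forall>A B. lie (J A) (J B) = lie A B)"


section \<open>Deformations\<close>

text \<open>A tensor $\sum_i \alpha_i \otimes V_i$ is given by the list of the pairs $(\alpha_i, V_i)$.
  Everything below depends on the tensor only, not on the chosen list.\<close>

type_synonym 'v tensor = "('v form1 \<times> 'v cplx) list"

definition tensors01_10 :: "('v::real_vector \<Rightarrow> 'v) \<Rightarrow> 'v tensor set" where
  "tensors01_10 J = {\<Phi>. set \<Phi> \<subseteq> forms01 J \<times> vecs10 J}"

definition tensor_conj :: "'v::real_vector tensor \<Rightarrow> 'v tensor" where
  "tensor_conj \<Phi> = map (\<lambda>(\<alpha>, V). (form_conj \<alpha>, cconj V)) \<Phi>"

definition on_vec :: "'v::real_vector tensor \<Rightarrow> 'v cplx \<Rightarrow> 'v cplx" where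
  "on_vec \<Phi> X = (\<Sum>(\<alpha>, V)\<leftarrow>\<Phi>. cscale (\<alpha> X) V)"

definition on_form :: "'v::real_vector tensor \<Rightarrow> 'v form1 \<Rightarrow> 'v form1" where
  "on_form \<Phi> \<omega> = (\<lambda>X. \<Sum>(\<alpha>, V)\<leftarrow>\<Phi>. \<omega> V * \<alpha> X)"

definition deformed_form :: "'v::real_vector tensor \<Rightarrow> 'v form1 \<Rightarrow> 'v form1" where
  "deformed_form \<Phi> \<omega> = (\<lambda>X. \<omega> X - on_form \<Phi> \<omega> X)"

definition deformed_vec :: "'v::real_vector tensor \<Rightarrow> 'v cplx \<Rightarrow> 'v cplx" where
  "deformed_vec \<Phi> X = X + on_vec \<Phi> X"

text \<open>Smallness of \<open>\<Phi>\<close>, in the form in which it is used: the space of deformed (0,1)-vectors and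
  its complex conjugate are complementary.\<close>

definition small :: "('v::real_vector \<Rightarrow> 'v) \<Rightarrow> 'v tensor \<Rightarrow> bool" where
  "small J \<Phi> \<longleftrightarrow>
     (let W = deformed_vec \<Phi> ` vecs01 J in
       W \<inter> cconj ` W = {0} \<and> {X + Y | X Y. X \<in> W \<and> Y \<in> cconj ` W} = UNIV)"

text \<open>The almost complex structure $J_\Phi$; it exists and is unique if \<open>\<Phi>\<close> is small.\<close>

definition deformed_structure :: "('v::real_vector \<Rightarrow> 'v) \<Rightarrow> 'v tensor \<Rightarrow> 'v \<Rightarrow> 'v" where
  "deformed_structure J \<Phi> = (THE J'. almost_complex J' \<and>
     forms10 J' = deformed_form \<Phi> ` forms10 J \<and>
     vecs01 J' = deformed_vec \<Phi> ` vecs01 J)"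

definition integrable_tensor ::
  "('v::real_vector \<Rightarrow> 'v \<Rightarrow> 'v) \<Rightarrow> ('v \<Rightarrow> 'v) \<Rightarrow> 'v tensor \<Rightarrow> bool" where
  "integrable_tensor lie J \<Phi> \<longleftrightarrow>
     (\<forall>\<omega>\<in>forms10 J. \<forall>X\<in>vecs01 J. \<forall>Y\<in>vecs01 J.
        ext_d lie (deformed_form \<Phi> \<omega>) (deformed_vec \<Phi> X) (deformed_vec \<Phi> Y) = 0)"

text \<open>The extended Schouten-Nijenhuis bracket of a tensor with a 1-form.\<close>

definition sn_bracket :: "('v::real_vector \<Rightarrow> 'v \<Rightarrow> 'v) \<Rightarrow> 'v tensor \<Rightarrow> 'v form1 \<Rightarrow> 'v form2" where
  "sn_bracket lie \<Psi> \<eta> =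
     (\<lambda>X Y. \<Sum>(\<alpha>, V)\<leftarrow>\<Psi>. wedge \<alpha> (interior_mult V (ext_d lie \<eta>)) X Y)"

end

theory Submission
  imports Defs
begin

text \<open>An almost complex structure is abelian iff the bracket vanishes on its (0,1)-vectors. Since a
  vector killed by all (1,0)-forms is of type (0,1), this holds iff every (1,0)-form $\eta$ satisfies
  $d\eta(W,W) = 0$ and $d\eta(\overline W,\overline W) = 0$, where $W$ is the space of (0,1)-vectors.
  For $J_\Phi$ the first condition is integrability. In the second one, $\overline W$ consists of the
  $X + \overline\Phi(X)$ with $X$ of type (1,0) for $J$; since $J$ is abelian, only the mixed terms
  $d\eta(\overline\Phi X, Y) + d\eta(X, \overline\Phi Y)$ survive, and they form the value of
  $\{\overline\Phi,\eta\}$ at $(X,Y)$.\<close>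

section \<open>The bracket of a Lie algebra of a Lie group\<close>

lemma left_invariant_field_smooth:
  "X \<in> left_invariant_fields G atlas \<Longrightarrow> f \<in> smooth_functions atlas \<Longrightarrow> X f \<in> smooth_functions atlas"
  by (simp add: left_invariant_fields_def)

lemma left_invariant_field_linear:
  assumes "X \<in> left_invariant_fields G atlas"
    and "f \<in> smooth_functions atlas" "h \<in> smooth_functions atlas"
  shows "X (\<lambda>x. r * f x + s * h x) = (\<lambda>x. r * X f x + s * X h x)"
  using assms by (simp add: left_invariant_fields_def)

lemma left_invariant_field_not_smooth:
  "X \<in> left_invariant_fields G atlas \<Longrightarrow> f \<notin> smooth_functions atlas \<Longrightarrow> X f = (\<lambda>x. 0)"
  by (simp add: left_invariant_fields_def)

text \<open>Serves the commutator at a non-smooth f: there one field yields the zero function, to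
  which the other field is then applied.\<close>

lemma left_invariant_field_zero:
  assumes "X \<in> left_invariant_fields G atlas"
  shows "X (\<lambda>x. 0) = (\<lambda>x. 0)"
proof (cases "(\<lambda>x. 0) \<in> smooth_functions atlas")
  case True
  show ?thesis
    using left_invariant_field_linear[OF assms True True, of 0 0] by simp
qed (simp add: left_invariant_field_not_smooth[OF assms])

text \<open>The map \<open>\<rho>\<close> is linear and injective, so identities between commutators
  of fields transfer to \<open>lie\<close>.\<close>

lemma lie_algebra_of_bracket:
  assumes "lie_algebra_of G atlas lie \<rho>"
  shows "bilinear lie" and "lie A B = - lie B A"
proof -
  have bij: "bij_betw \<rho> UNIV (left_invariant_fields G atlas)"
    and add: "\<And>A B f x. \<rho> (A + B) f x = \<rho> A f x + \<rho> B f x"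
    and scale: "\<And>r A f x. \<rho> (r *\<^sub>R A) f x = r * \<rho> A f x"
    and bracket: "\<And>A B f x. \<rho> (lie A B) f x = \<rho> A (\<rho> B f) x - \<rho> B (\<rho> A f) x"
    using assms unfolding lie_algebra_of_def by auto
  have field: "\<rho> A \<in> left_invariant_fields G atlas" for A
    using bij by (auto simp: bij_betw_def)
  have eqI: "A = B" if "\<And>f x. \<rho> A f x = \<rho> B f x" for A B
    using bij that by (metis bij_betw_def ext injD)
  \<comment> \<open>Linearity of a field is available on smooth f only. For any other f the default
    value makes both sides zero.\<close>
  have linear_image: "\<rho> C (\<rho> (r *\<^sub>R A + s *\<^sub>R B) f) x = r * \<rho> C (\<rho> A f) x + s * \<rho> C (\<rho> B f) x"
    for A B C r s f x
  proof -
    have *: "\<rho> (r *\<^sub>R A + s *\<^sub>R B) f = (\<lambda>x. r * \<rho> A f x + s * \<rho> B f x)"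
      by (rule ext) (simp add: add scale)
    show ?thesis
    proof (cases "f \<in> smooth_functions atlas")
      case True
      then show ?thesis
        unfolding *
        by (subst left_invariant_field_linear[OF field])
          (auto intro: left_invariant_field_smooth[OF field])
    next
      case False
      then show ?thesis
        by (simp add: * left_invariant_field_not_smooth[OF field] left_invariant_field_zero[OF field])
    qed
  qed
  have anti: "lie A B = - lie B A" for A B
  proof (rule eqI)
    show "\<rho> (lie A B) f x = \<rho> (- lie B A) f x" for f x
      using scale[of "-1" "lie B A" f x] by (simp add: bracket)
  qed
  have right: "lie C (r *\<^sub>R A + s *\<^sub>R B) = r *\<^sub>R lie C A + s *\<^sub>R lie C B" for A B C r s
    by (rule eqI) (simp add: bracket linear_image, simp add: add scale bracket algebra_simps)
  have lin: "linear (lie C)" for C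
  proof (rule linearI)
    show "lie C (A + B) = lie C A + lie C B" for A B
      using right[of C 1 A 1 B] by simp
    show "lie C (r *\<^sub>R A) = r *\<^sub>R lie C A" for r A
      using right[of C r A 0 A] by simp
  qed
  have "linear (\<lambda>A. lie A C)" for C
    using linear_compose_neg[OF lin[of C]] by (simp add: anti[of _ C])
  with lin show "bilinear lie"
    by (simp add: bilinear_def)
  show "lie A B = - lie B A"
    by (rule anti)
qed


section \<open>The complexification\<close>

lemma cscale_simps [simp]:
  "cscale c (X + Y) = cscale c X + cscale c Y"
  "cscale c 0 = 0"
  "cscale 0 X = 0"
  "cscale 1 X = X"
  "cscale c (cscale d X) = cscale (c * d) X"
  "cconj (cscale c X) = cscale (cnj c) (cconj X)"
  by (auto simp: cscale_def cconj_def algebra_simps prod_eq_iff)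

lemma cscale_add_left: "cscale (c + d) X = cscale c X + cscale d X"
  by (simp add: cscale_def algebra_simps)

lemma cconj_simps [simp]:
  "cconj (X + Y) = cconj X + cconj Y"
  "cconj 0 = 0"
  "cconj (cconj X) = X"
  by (auto simp: cconj_def prod_eq_iff)

lemma forms1I:
  assumes "\<And>X Y. \<eta> (X + Y) = \<eta> X + \<eta> Y" "\<And>c X. \<eta> (cscale c X) = c * \<eta> X"
  shows "\<eta> \<in> forms1"
  using assms unfolding forms1_def by blast

lemma form1_simps:
  assumes "\<eta> \<in> forms1"
  shows "\<eta> (X + Y) = \<eta> X + \<eta> Y" "\<eta> (cscale c X) = c * \<eta> X" "\<eta> 0 = 0"
proof -
  show *: "\<eta> (X + Y) = \<eta> X + \<eta> Y" "\<eta> (cscale c X) = c * \<eta> X" for X Y c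
    using assms unfolding forms1_def by blast+
  show "\<eta> 0 = 0"
    using *(2)[of 0 0] by simp
qed

lemma clie_bilinear:
  assumes "bilinear lie"
  shows "clie lie (X + X') Y = clie lie X Y + clie lie X' Y"
    "clie lie X (Y + Y') = clie lie X Y + clie lie X Y'"
    "clie lie (cscale c X) Y = cscale c (clie lie X Y)"
    "clie lie 0 Y = 0" "clie lie X 0 = 0"
  by (simp_all add: clie_def cscale_def prod_eq_iff bilinear_ladd[OF assms] bilinear_radd[OF assms]
      bilinear_lmul[OF assms] bilinear_rmul[OF assms] bilinear_lsub[OF assms] bilinear_rsub[OF assms]
      bilinear_lzero[OF assms] bilinear_rzero[OF assms] algebra_simps)

lemma clie_cconj:
  assumes "bilinear lie"
  shows "clie lie (cconj X) (cconj Y) = cconj (clie lie X Y)"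
  by (simp add: clie_def cconj_def bilinear_lneg[OF assms] bilinear_rneg[OF assms])

lemma clie_antisym:
  assumes "\<And>A B. lie A B = - lie B A"
  shows "clie lie X Y = - clie lie Y X"
  using assms[of "fst X"] assms[of "snd X"] by (simp add: clie_def)

lemma form1_uminus:
  assumes "\<eta> \<in> forms1"
  shows "\<eta> (- X) = - \<eta> X"
  using form1_simps(1,3)[OF assms] by (metis add_eq_0_iff add.right_inverse)

lemma ext_d_antisym:
  assumes "\<And>A B. lie A B = - lie B A" "\<eta> \<in> forms1"
  shows "ext_d lie \<eta> X Y = - ext_d lie \<eta> Y X"
  using clie_antisym[OF assms(1), where X = X and Y = Y] by (simp add: ext_d_def form1_uminus[OF assms(2)])

lemma ext_d_bilinear:
  assumes "bilinear lie" "\<eta> \<in> forms1"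
  shows "ext_d lie \<eta> (X + X') Y = ext_d lie \<eta> X Y + ext_d lie \<eta> X' Y"
    "ext_d lie \<eta> X (Y + Y') = ext_d lie \<eta> X Y + ext_d lie \<eta> X Y'"
    "ext_d lie \<eta> (cscale c X) Y = c * ext_d lie \<eta> X Y"
    "ext_d lie \<eta> 0 Y = 0"
  by (simp_all add: ext_d_def clie_bilinear[OF assms(1)] form1_simps[OF assms(2)])


section \<open>Almost complex structures\<close>

text \<open>The equation J(A + iB) = -i(A + iB) reads JA = B and JB = -A, and the second follows
  from the first. So the (0,1)-vectors form the graph of J, from which J can be recovered.\<close>

lemma vecs01_eq:
  assumes "almost_complex J"
  shows "vecs01 J = (\<lambda>A. (A, J A)) ` UNIV"
  using assms
  by (auto simp: vecs01_def almost_complex_def cmap_def cscale_def linear_neg image_iff)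

lemma mem_vecs01:
  assumes "almost_complex J"
  shows "(A, B) \<in> vecs01 J \<longleftrightarrow> B = J A"
  by (auto simp: vecs01_eq[OF assms])

lemma mem_vecs10:
  assumes "almost_complex J"
  shows "(A, B) \<in> vecs10 J \<longleftrightarrow> B = - J A"
  using assms
  by (auto simp: vecs10_def almost_complex_def cmap_def cscale_def linear_neg)

lemma vecs10_iff_cconj:
  assumes "almost_complex J"
  shows "X \<in> vecs10 J \<longleftrightarrow> cconj X \<in> vecs01 J"
proof (cases X)
  case (Pair A B)
  then show ?thesis
    by (simp add: cconj_def mem_vecs01[OF assms] mem_vecs10[OF assms]) (metis minus_minus)
qed

lemma vecs_closed:
  assumes "almost_complex J"
  shows "X \<in> vecs01 J \<Longrightarrow> Y \<in> vecs01 J \<Longrightarrow> X + Y \<in> vecs01 J" "X \<in> vecs01 J \<Longrightarrow> cscale c X \<in> vecs01 J"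
    "0 \<in> vecs01 J"
    "X \<in> vecs10 J \<Longrightarrow> Y \<in> vecs10 J \<Longrightarrow> X + Y \<in> vecs10 J" "X \<in> vecs10 J \<Longrightarrow> cscale c X \<in> vecs10 J"
    "0 \<in> vecs10 J"
proof -
  have J: "linear J" "\<And>A. J (J A) = - A"
    using assms by (auto simp: almost_complex_def)
  show *: "X \<in> vecs01 J \<Longrightarrow> Y \<in> vecs01 J \<Longrightarrow> X + Y \<in> vecs01 J"
    "X \<in> vecs01 J \<Longrightarrow> cscale c X \<in> vecs01 J" "0 \<in> vecs01 J" for X Y c
    by (auto simp: vecs01_eq[OF assms] image_iff cscale_def zero_prod_def linear_add[OF J(1)]
        linear_diff[OF J(1)] linear_scale[OF J(1)] linear_0[OF J(1)] J(2))
  show "X \<in> vecs10 J \<Longrightarrow> Y \<in> vecs10 J \<Longrightarrow> X + Y \<in> vecs10 J"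
    "X \<in> vecs10 J \<Longrightarrow> cscale c X \<in> vecs10 J" "0 \<in> vecs10 J"
    by (auto simp: vecs10_iff_cconj[OF assms] *)
qed

section \<open>Projections onto the two types, and the supply of (1,0)-forms\<close>

definition proj10 :: "('v::real_vector \<Rightarrow> 'v) \<Rightarrow> 'v cplx \<Rightarrow> 'v cplx" where
  "proj10 J X = cscale (1/2) (X + cscale (- \<i>) (cmap J X))"

definition proj01 :: "('v::real_vector \<Rightarrow> 'v) \<Rightarrow> 'v cplx \<Rightarrow> 'v cplx" where
  "proj01 J X = cscale (1/2) (X + cscale \<i> (cmap J X))"

lemma proj_decomp: "X = proj10 J X + proj01 J X"
  by (cases X) (simp add: proj10_def proj01_def cscale_def cmap_def flip: scaleR_add_right)

lemma proj_mem:
  assumes "almost_complex J"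
  shows "proj10 J X \<in> vecs10 J" "proj01 J X \<in> vecs01 J"
  using assms
  by (auto simp: proj10_def proj01_def vecs10_def vecs01_def almost_complex_def cmap_def cscale_def
      linear_add linear_diff linear_scale linear_neg algebra_simps)

lemma proj10_linear:
  assumes "almost_complex J"
  shows "proj10 J (X + Y) = proj10 J X + proj10 J Y" "proj10 J (cscale c X) = cscale c (proj10 J X)"
  using assms
  by (auto simp: proj10_def almost_complex_def cmap_def cscale_def prod_eq_iff
      linear_add linear_diff linear_scale linear_neg algebra_simps)

lemma proj10_eq:
  assumes "almost_complex J"
  shows "X \<in> vecs10 J \<Longrightarrow> proj10 J X = X" "X \<in> vecs01 J \<Longrightarrow> proj10 J X = 0"
  by (auto simp: proj10_def vecs10_def vecs01_def)
    (auto simp: cscale_def prod_eq_iff simp flip: scaleR_add_left)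

lemma vecs01_if_forms10_vanish:
  assumes "almost_complex J" and vanish: "\<And>\<eta>. \<eta> \<in> forms10 J \<Longrightarrow> \<eta> X = 0"
  shows "X \<in> vecs01 J"
proof -
  have J: "linear J" "\<And>A. J (J A) = - A"
    using assms by (auto simp: almost_complex_def)
  \<comment> \<open>The map \<open>P\<close> identifies the quotient by the (0,1)-vectors with the real space carrying \<open>J\<close>,
    so each real functional \<open>f\<close> induces a (1,0)-form.\<close>
  define P where "P Z = fst Z + J (snd Z)" for Z :: "'a cplx"
  have P_add: "P (Y + Z) = P Y + P Z" and P_scale: "P (cscale c Z) = Re c *\<^sub>R P Z + Im c *\<^sub>R J (P Z)"
    for Y Z c
    by (simp_all add: P_def cscale_def linear_add[OF J(1)] linear_diff[OF J(1)] linear_scale[OF J(1)]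
        J(2) algebra_simps)
  have "f (P X) = 0" if "linear f" for f :: "'a \<Rightarrow> real"
  proof -
    \<comment> \<open>The imaginary part is forced by the real part: complex linearity requires
      \<eta>(iZ) = i \<eta>(Z), and P(iZ) = J(P Z).\<close>
    define \<eta> where "\<eta> Z = Complex (f (P Z)) (- f (J (P Z)))" for Z
    have "\<eta> \<in> forms1"
      by (rule forms1I) (simp_all add: \<eta>_def P_add P_scale complex_eq_iff linear_add[OF J(1)]
          linear_diff[OF J(1)] linear_scale[OF J(1)] linear_add[OF that] linear_diff[OF that]
          linear_scale[OF that] J(2) linear_neg[OF that])
    moreover have "\<eta> Z = 0" if "Z \<in> vecs01 J" for Z
      using that by (auto simp: vecs01_eq[OF assms(1)] \<eta>_def P_def J(2) linear_0[OF J(1)]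
          linear_0[OF \<open>linear f\<close>] complex_eq_iff)
    ultimately have "\<eta> \<in> forms10 J"
      by (simp add: forms10_def)
    from vanish[OF this] show ?thesis
      by (simp add: \<eta>_def complex_eq_iff)
  qed
  \<comment> \<open>Real functionals separate points in any dimension: prescribe 1 on A and extend
    linearly.\<close>
  moreover have "\<exists>f::'a \<Rightarrow> real. linear f \<and> f A = 1" if "A \<noteq> 0" for A
    using linear_independent_extend[of "{A}" "\<lambda>_. 1::real"] that by auto
  ultimately have "P X = 0"
    by force
  then have "J (fst X) = snd X"
    using J by (metis P_def add.inverse_inverse add_eq_0_iff linear_neg)
  then show ?thesis
    by (cases X) (simp add: mem_vecs01[OF assms(1)])
qed

section \<open>Abelian structures in terms of brackets and differentials\<close>

text \<open>The bracket of A + iJA and B + iJB has real part [A,B] - [JA,JB] and imaginary part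
  [A,JB] + [JA,B]. The real part expresses the abelian condition, and the imaginary part vanishes by
  that condition with JB in place of B. Integrability is then automatic, as every form vanishes at
  0.\<close>

lemma abelian_iff_clie_vecs01:
  assumes "bilinear lie" "almost_complex J"
  shows "abelian_complex_structure lie J \<longleftrightarrow> (\<forall>X\<in>vecs01 J. \<forall>Y\<in>vecs01 J. clie lie X Y = 0)"
proof -
  have JJ: "J (J A) = - A" for A
    using assms by (auto simp: almost_complex_def)
  have *: "(\<forall>A B. lie (J A) (J B) = lie A B) \<longleftrightarrow> (\<forall>X\<in>vecs01 J. \<forall>Y\<in>vecs01 J. clie lie X Y = 0)"
  proof
    assume inv: "\<forall>A B. lie (J A) (J B) = lie A B"
    have "lie A (J B) + lie (J A) B = 0" for A B
      using inv[rule_format, of A "J B"] by (simp add: JJ bilinear_rneg[OF assms(1)] add_eq_0_iff2)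
    with inv show "\<forall>X\<in>vecs01 J. \<forall>Y\<in>vecs01 J. clie lie X Y = 0"
      by (simp add: vecs01_eq[OF assms(2)] clie_def zero_prod_def)
  qed (simp add: vecs01_eq[OF assms(2)] clie_def zero_prod_def)
  have "complex_structure lie J" if "\<forall>X\<in>vecs01 J. \<forall>Y\<in>vecs01 J. clie lie X Y = 0"
    using that assms(2) form1_simps(3) by (auto simp: complex_structure_def ext_d_def forms10_def)
  with * show ?thesis
    by (auto simp: abelian_complex_structure_def)
qed

text \<open>Since d\<eta>(X,Y) = -\<eta>([X,Y]), the two conditions say that all (1,0)-forms kill
  [X,Y] and its conjugate. Both are then of type (0,1), and the (0,1)-vectors meet their conjugates
  only in 0.\<close>

lemma abelian_iff_ext_d:
  assumes "bilinear lie" "almost_complex J"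
  shows "abelian_complex_structure lie J \<longleftrightarrow>
    (\<forall>\<eta>\<in>forms10 J. \<forall>X\<in>vecs01 J. \<forall>Y\<in>vecs01 J.
      ext_d lie \<eta> X Y = 0 \<and> ext_d lie \<eta> (cconj X) (cconj Y) = 0)"
  unfolding abelian_iff_clie_vecs01[OF assms]
proof (intro iffI ballI)
  fix \<eta> X Y
  assume "\<forall>X\<in>vecs01 J. \<forall>Y\<in>vecs01 J. clie lie X Y = 0" "\<eta> \<in> forms10 J" "X \<in> vecs01 J" "Y \<in> vecs01 J"
  then show "ext_d lie \<eta> X Y = 0 \<and> ext_d lie \<eta> (cconj X) (cconj Y) = 0"
    by (auto simp: ext_d_def clie_cconj[OF assms(1)] forms10_def form1_simps)
next
  fix X Y
  assume d: "\<forall>\<eta>\<in>forms10 J. \<forall>X\<in>vecs01 J. \<forall>Y\<in>vecs01 J.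
      ext_d lie \<eta> X Y = 0 \<and> ext_d lie \<eta> (cconj X) (cconj Y) = 0"
    and XY: "X \<in> vecs01 J" "Y \<in> vecs01 J"
  obtain A B where AB: "clie lie X Y = (A, B)"
    by (cases "clie lie X Y")
  have "(A, B) \<in> vecs01 J" "cconj (A, B) \<in> vecs01 J"
    using d XY by (auto intro!: vecs01_if_forms10_vanish[OF assms(2)]
        simp: ext_d_def clie_cconj[OF assms(1)] simp flip: AB)
  then have B: "B = J A" "- B = J A"
    by (auto simp: mem_vecs01[OF assms(2)] cconj_def)
  then have "(1/2) *\<^sub>R (B + B) = 0"
    by (metis add.right_inverse scaleR_zero_right)
  then have "B = 0"
    by (simp only: scaleR_half_double)
  moreover have "J (J A) = - A" "J 0 = 0"
    using assms(2) by (auto simp: almost_complex_def linear_0)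
  ultimately show "clie lie X Y = 0"
    using AB B by (simp add: zero_prod_def)
qed


section \<open>The deformed structure\<close>

lemma on_vec_simps [simp]:
  "on_vec [] X = 0"
  "on_vec ((\<alpha>, V) # \<Phi>) X = cscale (\<alpha> X) V + on_vec \<Phi> X"
  by (simp_all add: on_vec_def)

lemma on_vec_linear:
  assumes "\<Phi> \<in> tensors01_10 J"
  shows "on_vec \<Phi> (X + Y) = on_vec \<Phi> X + on_vec \<Phi> Y"
    "on_vec \<Phi> (cscale c X) = cscale c (on_vec \<Phi> X)"
  using assms
  by (induction \<Phi>)
    (auto simp: tensors01_10_def forms01_def form1_simps cscale_add_left algebra_simps)

lemma on_vec_vecs10:
  assumes "\<Phi> \<in> tensors01_10 J" "X \<in> vecs10 J"
  shows "on_vec \<Phi> X = 0"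
  using assms by (induction \<Phi>) (auto simp: tensors01_10_def forms01_def)

lemma on_vec_mem:
  assumes "almost_complex J" "\<Phi> \<in> tensors01_10 J"
  shows "on_vec \<Phi> X \<in> vecs10 J"
  using assms(2)
  by (induction \<Phi>) (auto simp: tensors01_10_def intro!: vecs_closed[OF assms(1)])

lemma on_vec_tensor_conj: "on_vec (tensor_conj \<Phi>) X = cconj (on_vec \<Phi> (cconj X))"
  by (induction \<Phi>) (auto simp: tensor_conj_def form_conj_def)

text \<open>The action on forms is the transpose of the action on vectors, so later arguments can
  work with \<open>on_vec\<close> alone.\<close>

lemma on_form_eq:
  assumes "\<omega> \<in> forms1"
  shows "on_form \<Phi> \<omega> X = \<omega> (on_vec \<Phi> X)"
  by (induction \<Phi>) (auto simp: on_form_def form1_simps[OF assms] mult.commute)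

lemma deformed_form_eq:
  assumes "\<omega> \<in> forms1"
  shows "deformed_form \<Phi> \<omega> X = \<omega> X - \<omega> (on_vec \<Phi> X)"
  by (simp add: deformed_form_def on_form_eq[OF assms])

lemma deformed_form_forms1:
  assumes "\<Phi> \<in> tensors01_10 J" "\<omega> \<in> forms1"
  shows "deformed_form \<Phi> \<omega> \<in> forms1"
  by (rule forms1I) (simp_all add: deformed_form_eq[OF assms(2)] form1_simps[OF assms(2)]
      on_vec_linear[OF assms(1)] algebra_simps)

text \<open>As a map on vectors \<Phi> squares to zero: it has values of type (1,0) and kills these.
  Hence \<omega> - \<omega> \<Phi> takes X + \<Phi>(X) to \<omega>(\<Phi> X) - \<omega>(\<Phi> X) =
  0. So the deformed (1,0)-forms are determined by the deformed (0,1)-vectors.\<close>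

lemma deformed_forms10:
  assumes "almost_complex J" "\<Phi> \<in> tensors01_10 J"
  shows "deformed_form \<Phi> ` forms10 J = {\<eta> \<in> forms1. \<forall>X\<in>deformed_vec \<Phi> ` vecs01 J. \<eta> X = 0}"
proof (intro equalityI subsetI)
  fix \<eta>
  assume "\<eta> \<in> deformed_form \<Phi> ` forms10 J"
  then obtain \<omega> where \<omega>: "\<omega> \<in> forms1" "\<And>X. X \<in> vecs01 J \<Longrightarrow> \<omega> X = 0" "\<eta> = deformed_form \<Phi> \<omega>"
    by (auto simp: forms10_def)
  have "\<eta> (deformed_vec \<Phi> X) = 0" if "X \<in> vecs01 J" for X
    by (simp add: \<omega>(2)[OF that] \<omega>(3) deformed_form_eq[OF \<omega>(1)] deformed_vec_def on_vec_linear[OF assms(2)]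
        on_vec_vecs10[OF assms(2) on_vec_mem[OF assms]] form1_simps[OF \<omega>(1)])
  then show "\<eta> \<in> {\<eta> \<in> forms1. \<forall>X\<in>deformed_vec \<Phi> ` vecs01 J. \<eta> X = 0}"
    using deformed_form_forms1[OF assms(2) \<omega>(1)] \<omega>(3) by auto
next
  fix \<eta>
  assume "\<eta> \<in> {\<eta> \<in> forms1. \<forall>X\<in>deformed_vec \<Phi> ` vecs01 J. \<eta> X = 0}"
  then have \<eta>: "\<eta> \<in> forms1" and vanish: "\<And>X. X \<in> vecs01 J \<Longrightarrow> \<eta> X + \<eta> (on_vec \<Phi> X) = 0"
    by (auto simp: deformed_vec_def form1_simps)
  \<comment> \<open>By \<open>vanish\<close>, \<eta> is determined by its values on (1,0)-vectors;
    \<omega> keeps these values and is zero on (0,1)-vectors.\<close>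
  define \<omega> where "\<omega> X = \<eta> (proj10 J X)" for X
  have \<omega>: "\<omega> \<in> forms1"
    by (rule forms1I) (simp_all add: \<omega>_def proj10_linear[OF assms(1)] form1_simps[OF \<eta>])
  then have "\<omega> \<in> forms10 J"
    by (simp add: forms10_def) (simp add: \<omega>_def proj10_eq[OF assms(1)] form1_simps[OF \<eta>])
  moreover have "deformed_form \<Phi> \<omega> X = \<eta> X" for X
  proof -
    let ?Y = "proj10 J X" and ?Z = "proj01 J X"
    have "on_vec \<Phi> X = on_vec \<Phi> ?Y + on_vec \<Phi> ?Z"
      by (subst proj_decomp[of X J]) (rule on_vec_linear(1)[OF assms(2)])
    then have "on_vec \<Phi> X = on_vec \<Phi> ?Z"
      by (simp add: on_vec_vecs10[OF assms(2) proj_mem(1)[OF assms(1)]])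
    then have "deformed_form \<Phi> \<omega> X = \<eta> ?Y - \<eta> (on_vec \<Phi> ?Z)"
      by (simp add: deformed_form_eq[OF \<omega>]) (simp add: \<omega>_def proj10_eq(1)[OF assms(1) on_vec_mem[OF assms]])
    also have "\<dots> = \<eta> ?Y + \<eta> ?Z"
      using vanish[OF proj_mem(2)[OF assms(1), of X]] by (simp add: algebra_simps add_eq_0_iff)
    also have "\<dots> = \<eta> X"
      \<comment> \<open>X also occurs inside both projections; only its third occurrence, on the
        right, is to be split.\<close>
      by (subst (3) proj_decomp[of X J]) (rule form1_simps(1)[OF \<eta>, symmetric])
    finally show ?thesis .
  qed
  ultimately show "\<eta> \<in> deformed_form \<Phi> ` forms10 J"
    by (metis ext image_eqI)
qed

section \<open>Existence and uniqueness of the deformed structure\<close>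

text \<open>A complex subspace complementary to its conjugate is the graph of a real map: a trivial
  intersection makes the imaginary part unique, a full sum makes it exist for each real
  part.\<close>

lemma ex_almost_complex_vecs01:
  fixes W :: "'v::real_vector cplx set"
  assumes W_add: "\<And>X Y. X \<in> W \<Longrightarrow> Y \<in> W \<Longrightarrow> X + Y \<in> W" and W_scale: "\<And>c X. X \<in> W \<Longrightarrow> cscale c X \<in> W"
    and inter: "W \<inter> cconj ` W = {0}" and sum: "{X + Y | X Y. X \<in> W \<and> Y \<in> cconj ` W} = UNIV"
  shows "\<exists>J. almost_complex J \<and> vecs01 J = W"
proof -
  have zero: "B = 0" if "(0, B) \<in> W" for B
  proof -
    \<comment> \<open>The pair stands for iB, whose conjugate is its negative; it therefore puts a
      vector into both W and the conjugate of W.\<close>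
    have "cscale (-1) (0, B) \<in> W"
      using that by (rule W_scale)
    moreover have "cscale (-1) (0, B) = cconj (0, B)"
      by (simp add: cscale_def cconj_def)
    ultimately have "cconj (0, B) \<in> W \<inter> cconj ` W"
      using that by auto
    then have "cconj (0, B) = 0"
      unfolding inter by blast
    then show ?thesis
      by (simp add: cconj_def zero_prod_def)
  qed
  have unique: "B = C" if "(A, B) \<in> W" "(A, C) \<in> W" for A B C
  proof -
    have "(A, B) + cscale (-1) (A, C) \<in> W"
      using that by (intro W_add W_scale)
    then show ?thesis
      using zero[of "B - C"] by (simp add: cscale_def)
  qed
  have ex: "\<exists>B. (A, B) \<in> W" for A
  proof -
    have "(A, 0) \<in> {X + Y | X Y. X \<in> W \<and> Y \<in> cconj ` W}"
      unfolding sum by simp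
    then obtain X Y where "(A, 0) = X + cconj Y" "X \<in> W" "Y \<in> W"
      by blast
    \<comment> \<open>Conjugation preserves real parts, so X + Y has the same real part as X +
      \<open>cconj Y\<close>, and it lies in W.\<close>
    then have "(A, snd (X + Y)) = X + Y" "X + Y \<in> W"
      by (auto simp: cconj_def prod_eq_iff W_add)
    then show ?thesis
      by metis
  qed
  define J where "J A = (THE B. (A, B) \<in> W)" for A
  have J_mem: "(A, J A) \<in> W" for A
    unfolding J_def using ex unique by (metis theI)
  then have J_eq: "(A, B) \<in> W \<longleftrightarrow> B = J A" for A B
    using unique by blast
  have "linear J"
  proof (rule linearI)
    show "J (A + B) = J A + J B" for A B
      using W_add[OF J_mem J_mem, of A B] by (simp add: J_eq)
    show "J (r *\<^sub>R A) = r *\<^sub>R J A" for r A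
      using W_scale[OF J_mem, of "of_real r" A] by (simp add: J_eq cscale_def)
  qed
  moreover have "J (J A) = - A" for A
    \<comment> \<open>Multiplication by -i takes A + iJA to JA - iA, which lies on the graph only if
      J(JA) = -A.\<close>
    using W_scale[OF J_mem, of "- \<i>" A] by (simp add: J_eq cscale_def)
  ultimately have "almost_complex J"
    by (simp add: almost_complex_def)
  moreover from this have "vecs01 J = W"
    by (auto simp: mem_vecs01 J_eq)
  ultimately show ?thesis
    by blast
qed

text \<open>Resolves the definite description: the condition on forms follows from the one on
  vectors by taking annihilators, and a structure is determined by its (0,1)-vectors, which are its
  graph.\<close>

lemma deformed_structure:
  assumes "almost_complex J" "\<Phi> \<in> tensors01_10 J" "small J \<Phi>"
  shows "almost_complex (deformed_structure J \<Phi>)"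
    "forms10 (deformed_structure J \<Phi>) = deformed_form \<Phi> ` forms10 J"
    "vecs01 (deformed_structure J \<Phi>) = deformed_vec \<Phi> ` vecs01 J"
proof -
  let ?W = "deformed_vec \<Phi> ` vecs01 J"
  let ?P = "\<lambda>J'. almost_complex J' \<and> forms10 J' = deformed_form \<Phi> ` forms10 J \<and> vecs01 J' = ?W"
  have "\<exists>J'. almost_complex J' \<and> vecs01 J' = ?W"
  proof (rule ex_almost_complex_vecs01)
    show "X + Y \<in> ?W" if "X \<in> ?W" "Y \<in> ?W" for X Y
    proof -
      obtain X' Y' where "X = deformed_vec \<Phi> X'" "Y = deformed_vec \<Phi> Y'" "X' \<in> vecs01 J" "Y' \<in> vecs01 J"
        using \<open>X \<in> ?W\<close> \<open>Y \<in> ?W\<close> by blast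
      then show ?thesis
        by (intro image_eqI[of _ _ "X' + Y'"])
          (auto simp: deformed_vec_def on_vec_linear[OF assms(2)] vecs_closed[OF assms(1)])
    qed
    show "cscale c X \<in> ?W" if "X \<in> ?W" for c X
    proof -
      obtain X' where "X = deformed_vec \<Phi> X'" "X' \<in> vecs01 J"
        using \<open>X \<in> ?W\<close> by blast
      then show ?thesis
        by (intro image_eqI[of _ _ "cscale c X'"])
          (auto simp: deformed_vec_def on_vec_linear[OF assms(2)] vecs_closed[OF assms(1)])
    qed
  qed (use assms(3) in \<open>auto simp: small_def Let_def\<close>)
  then obtain J' where J': "almost_complex J'" "vecs01 J' = ?W"
    by blast
  then have "forms10 J' = deformed_form \<Phi> ` forms10 J"
    unfolding deformed_forms10[OF assms(1,2)] forms10_def[of J'] by (simp only:)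
  with J' have "\<exists>J'. ?P J'"
    by blast
  moreover have "J1 = J2" if "?P J1" "?P J2" for J1 J2
  proof
    show "J1 A = J2 A" for A
      using that mem_vecs01[of J1 A] mem_vecs01[of J2 A] by metis
  qed
  ultimately have "\<exists>!J'. ?P J'"
    by (rule ex_ex1I)
  then have "?P (deformed_structure J \<Phi>)"
    unfolding deformed_structure_def by (rule theI')
  then show "almost_complex (deformed_structure J \<Phi>)"
    "forms10 (deformed_structure J \<Phi>) = deformed_form \<Phi> ` forms10 J"
    "vecs01 (deformed_structure J \<Phi>) = deformed_vec \<Phi> ` vecs01 J"
    by blast+
qed


section \<open>The Schouten-Nijenhuis bracket\<close>

text \<open>Each summand contributes \<alpha>(X) d\<eta>(V,Y) - \<alpha>(Y) d\<eta>(V,X); linearity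
  of d\<eta> in its first argument collects the sums into the images of X and Y under the
  tensor.\<close>

lemma sn_bracket_eq:
  assumes "bilinear lie" "\<eta> \<in> forms1"
  shows "sn_bracket lie \<Psi> \<eta> X Y = ext_d lie \<eta> (on_vec \<Psi> X) Y - ext_d lie \<eta> (on_vec \<Psi> Y) X"
  by (induction \<Psi>)
    (auto simp: sn_bracket_def wedge_def interior_mult_def ext_d_bilinear[OF assms])

text \<open>The projections allow X and Y to be arbitrary: the bracket sees only their (1,0)-parts,
  because the conjugate tensor kills (0,1)-vectors and has values of type (0,1), where d\<eta>
  vanishes on pairs.\<close>

lemma sn_bracket_conj_eq:
  assumes "bilinear lie" and anti: "\<And>A B. lie A B = - lie B A"
    and "abelian_complex_structure lie J" "\<Phi> \<in> tensors01_10 J" "\<eta> \<in> forms1"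
  shows "sn_bracket lie (tensor_conj \<Phi>) \<eta> X Y =
    ext_d lie \<eta> (cconj (deformed_vec \<Phi> (cconj (proj10 J X)))) (cconj (deformed_vec \<Phi> (cconj (proj10 J Y))))"
proof -
  have J: "almost_complex J"
    using assms(3) by (simp add: abelian_complex_structure_def complex_structure_def)
  let ?\<Psi> = "on_vec (tensor_conj \<Phi>)" and ?d = "ext_d lie \<eta>" and ?p = "proj10 J" and ?q = "proj01 J"
  have d01: "?d U V = 0" if "U \<in> vecs01 J" "V \<in> vecs01 J" for U V
    using assms(3) that
    by (simp add: abelian_iff_clie_vecs01[OF assms(1) J] ext_d_def form1_simps[OF assms(5)])
  have d10: "?d U V = 0" if "U \<in> vecs10 J" "V \<in> vecs10 J" for U V
  proof -
    have "clie lie U V = cconj (clie lie (cconj U) (cconj V))"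
      by (simp add: clie_cconj[OF assms(1), symmetric])
    also have "\<dots> = 0"
      using assms(3) that
      by (simp add: abelian_iff_clie_vecs01[OF assms(1) J] vecs10_iff_cconj[OF J])
    finally show ?thesis
      by (simp add: ext_d_def form1_simps[OF assms(5)])
  qed
  have \<Psi>_mem: "?\<Psi> U \<in> vecs01 J" for U
    using on_vec_mem[OF J assms(4), of "cconj U"] by (simp add: on_vec_tensor_conj vecs10_iff_cconj[OF J])
  have \<Psi>_proj: "?\<Psi> U = ?\<Psi> (?p U)" for U
  proof -
    have "?\<Psi> U = ?\<Psi> (?p U) + ?\<Psi> (?q U)"
      by (subst proj_decomp[of U J]) (simp add: on_vec_tensor_conj on_vec_linear[OF assms(4)])
    moreover have "?\<Psi> (?q U) = 0"
      using proj_mem(2)[OF J, of U]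
      by (simp add: on_vec_tensor_conj on_vec_vecs10[OF assms(4)] vecs10_iff_cconj[OF J])
    ultimately show ?thesis
      by simp
  qed
  have d_proj: "?d (?\<Psi> U) V = ?d (?\<Psi> (?p U)) (?p V)" for U V
  proof -
    have "?d (?\<Psi> U) V = ?d (?\<Psi> U) (?p V) + ?d (?\<Psi> U) (?q V)"
      by (subst proj_decomp[of V J]) (rule ext_d_bilinear(2)[OF assms(1,5)])
    then show ?thesis
      by (simp add: d01[OF \<Psi>_mem proj_mem(2)[OF J]] \<Psi>_proj[of U])
  qed
  have "?d (?p X + ?\<Psi> (?p X)) (?p Y + ?\<Psi> (?p Y)) = ?d (?p X) (?\<Psi> (?p Y)) + ?d (?\<Psi> (?p X)) (?p Y)"
    by (simp add: ext_d_bilinear[OF assms(1,5)] d01[OF \<Psi>_mem \<Psi>_mem] d10 proj_mem[OF J])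
  \<comment> \<open>Antisymmetry of d\<eta> moves the image of the tensor into the first argument,
    as in \<open>sn_bracket_eq\<close>.\<close>
  also have "\<dots> = ?d (?\<Psi> (?p X)) (?p Y) - ?d (?\<Psi> (?p Y)) (?p X)"
    by (simp add: ext_d_antisym[OF anti assms(5), where X = "?p X"])
  also have "\<dots> = sn_bracket lie (tensor_conj \<Phi>) \<eta> X Y"
    by (simp add: sn_bracket_eq[OF assms(1,5)] d_proj[of X Y] d_proj[of Y X])
  finally show ?thesis
    by (simp add: deformed_vec_def on_vec_tensor_conj)
qed

lemma sn_bracket_conj_zero_iff:
  assumes "bilinear lie" "\<And>A B. lie A B = - lie B A"
    and "abelian_complex_structure lie J" "\<Phi> \<in> tensors01_10 J" "\<eta> \<in> forms1"
  shows "sn_bracket lie (tensor_conj \<Phi>) \<eta> = (\<lambda>X Y. 0) \<longleftrightarrow>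
    (\<forall>X\<in>vecs01 J. \<forall>Y\<in>vecs01 J.
      ext_d lie \<eta> (cconj (deformed_vec \<Phi> X)) (cconj (deformed_vec \<Phi> Y)) = 0)"
proof -
  have J: "almost_complex J"
    using assms(3) by (simp add: abelian_complex_structure_def complex_structure_def)
  \<comment> \<open>Together with \<open>mem\<close> this shows that
    \<open>cconj (proj10 J X)\<close> runs through exactly the (0,1)-vectors, which removes the
    projections from the quantified identity.\<close>
  have surj: "X = cconj (proj10 J (cconj X))" if "X \<in> vecs01 J" for X
    using that by (simp add: proj10_eq(1)[OF J] vecs10_iff_cconj[OF J])
  have mem: "cconj (proj10 J X) \<in> vecs01 J" for X
    using proj_mem(1)[OF J, of X] by (simp add: vecs10_iff_cconj[OF J])
  show ?thesis
    unfolding fun_eq_iff sn_bracket_conj_eq[OF assms] using surj mem by metis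
qed

theorem theorem4:
  fixes G :: "('g::{t2_space,second_countable_topology}, 'm) monoid_scheme"
    and atlas :: "('g set \<times> ('g \<Rightarrow> 'e::real_normed_vector)) set"
    and \<Gamma> :: "'g set"
    and lie :: "'v::real_vector \<Rightarrow> 'v \<Rightarrow> 'v"
    and \<rho> :: "'v \<Rightarrow> ('g \<Rightarrow> real) \<Rightarrow> 'g \<Rightarrow> real"
    and J :: "'v \<Rightarrow> 'v"
    and \<Phi> :: "'v tensor"
  assumes "lie_group G atlas"
    and "simply_connected (UNIV :: 'g set)"
    and "nilpotent_group G"
    and "cocompact_lattice G \<Gamma>"
    and "lie_algebra_of G atlas lie \<rho>"
    and "abelian_complex_structure lie J"
    and "\<Phi> \<in> tensors01_10 J"
    and "small J \<Phi>"
  shows "abelian_complex_structure lie (deformed_structure J \<Phi>) \<longleftrightarrow>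
    integrable_tensor lie J \<Phi> \<and>
    (\<forall>\<omega>\<in>forms10 J. sn_bracket lie (tensor_conj \<Phi>) (deformed_form \<Phi> \<omega>) = (\<lambda>X Y. 0))"
proof -
  note lie = lie_algebra_of_bracket[OF assms(5)]
  have J: "almost_complex J"
    using assms(6) by (simp add: abelian_complex_structure_def complex_structure_def)
  note J' = deformed_structure[OF J assms(7,8)]
  have bracket_zero: "sn_bracket lie (tensor_conj \<Phi>) (deformed_form \<Phi> \<omega>) = (\<lambda>X Y. 0) \<longleftrightarrow>
      (\<forall>X\<in>vecs01 J. \<forall>Y\<in>vecs01 J.
        ext_d lie (deformed_form \<Phi> \<omega>) (cconj (deformed_vec \<Phi> X)) (cconj (deformed_vec \<Phi> Y)) = 0)"
    if "\<omega> \<in> forms10 J" for \<omega>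
    using that
    by (intro sn_bracket_conj_zero_iff[OF lie assms(6,7)] deformed_form_forms1[OF assms(7)])
      (simp add: forms10_def)
  \<comment> \<open>Quantifiers over deformed forms and vectors become quantifiers over the
    undeformed ones; the conjunction then splits into integrability and the vanishing of the
    bracket.\<close>
  show ?thesis
    unfolding abelian_iff_ext_d[OF lie(1) J'(1)] J'(2,3) integrable_tensor_def
    by (simp only: ball_simps bracket_zero ball_conj_distrib cong: ball_cong)
qed

end
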